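(* Let $M=\{X\in E:\ C(X)=0\}$ be a smooth feasible set, with $C'(X)$ of full rank (onto $E_L$) for $X\in M$, and let $\Pi:M\to \mathrm{Lin}(E,E)$ be a smooth projection function, i.e. $\Pi(X)^2=\Pi(X)$ with $\Pi(X)$ of rank $\dim E-\dim E_L$ for every $X\in M$. Let $F$ be a smooth function from $M$ to $E$ satisfying $$\Pi(X)F(X)=F(X)\qquad (X\in M).$$ Let $X_*\in M$ be a solution of $F(X_* )=0$, let $\mathfrak r$ be a retraction around $X_*$, and assume that the linear system $$\Pi(X)F'(X)\eta=-F(X),\qquad C'(X)\eta=0 \qquad\text{(unknown } \eta\in E)$$ is non-degenerate at $X=X_*$, i.e. the linear map $\eta\mapsto \Pi(X_* )F'(X_* )\eta$ from $T_{X_*}$ to $\mathrm{Im}\,\Pi(X_* )$ is invertible. Then, for every initial point $X_0\in M$ sufficiently close to $X_*$, the iteration $$X_{i+1}=\mathfrak r(X_i,\eta_i),$$ where $\eta_i\in T_{X_i}$ is the solution of $\Pi(X_i)F'(X_i)\eta_i=-F(X_i)$, $C'(X_i)\eta_i=0$, is well-defined and converges quadratically to $X_*$.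
   Context: $E$ and $E_L$ are finite-dimensional real inner product spaces, $\mathrm{Lin}(V,W)$ is the space of linear maps $V\to W$, $C:E\to E_L$ is smooth, and $C'(X)\in\mathrm{Lin}(E,E_L)$ is its Jacobian. "Smooth" means sufficiently differentiable. $T_X=\mathrm{Null}(C'(X))$ is the tangent space of $M$ at $X\in M$ and $TM=\{(X,\eta):X\in M,\ \eta\in T_X\}$. For $\eta\in T_X$, $F'(X)\eta$ is the directional derivative of $F$ along $\eta$ ($F$ may be regarded as smoothly extended to a neighborhood of $M$ in $E$; the derivative in tangent directions does not depend on the extension). Retraction: a retraction around $X_f\in M$ is a smooth map $\mathfrak r$ from an open subset $\mathtt T_{\mathfrak r}\subset TM$ to $M$, whose range contains a neighborhood $\Omega\subset M$ of $X_f$, such that for some $\rho_{\mathfrak r}>0$ the set $\mathtt T_{\mathfrak r}$ contains all $(X,\eta)\in TM$ with $X\in\Omega$, $|\eta|<\rho_{\mathfrak r}$, and such that whenever $\mathfrak r(X,0)$ is defined, $\mathfrak r(X,0)=X$ and the derivative of $\eta\mapsto \mathfrak r(X,\eta)$ at $\eta=0$ is the identity of $T_X$ (so $\mathfrak r(X,\eta)=X+\eta+O(|\eta|^2)$). Quadratic convergence of $X_i$ to $X_*$: $X_i\to X_*$ and there is $M_0$ with $|X_{i+1}-X_*|\le M_0|X_i-X_*|^2$ for all large $i$. *)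

theory Defs
  imports "HOL-Analysis.Analysis"
begin

(* Order-k continuous differentiability on an open set. Quantifying over directions v avoids
   the growing types of iterated derivatives; for a finite-dimensional domain this is
   the usual class C^k. *)
primrec Ck_on :: "nat \<Rightarrow> 'a::real_normed_vector set \<Rightarrow> ('a \<Rightarrow> 'b::real_normed_vector) \<Rightarrow> bool" where
  "Ck_on 0 U f \<longleftrightarrow> continuous_on U f"
| "Ck_on (Suc k) U f \<longleftrightarrow>
     (\<forall>x\<in>U. f differentiable (at x)) \<and> (\<forall>v. Ck_on k U (\<lambda>x. frechet_derivative f (at x) v))"

(* "Smooth" means sufficiently differentiable; order 2 is enough here, and C^k with k > 2 or
   C^infinity maps are included. A map on a set that is not open is smooth if
   it extends near each point of the set to a smooth map on an open subset of the ambient space. *)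
definition smooth_on :: "'a::real_normed_vector set \<Rightarrow> ('a \<Rightarrow> 'b::real_normed_vector) \<Rightarrow> bool" where
  "smooth_on S f \<longleftrightarrow>
     (\<forall>x\<in>S. \<exists>U g. open U \<and> x \<in> U \<and> Ck_on 2 U g \<and> (\<forall>y\<in>S \<inter> U. g y = f y))"

definition feasible_set :: "('a::real_normed_vector \<Rightarrow> 'b::real_normed_vector) \<Rightarrow> 'a set" where
  "feasible_set C = {X. C X = 0}"

definition tangent_space :: "('a::real_normed_vector \<Rightarrow> 'b::real_normed_vector) \<Rightarrow> 'a \<Rightarrow> 'a set" where
  "tangent_space C X = {\<eta>. frechet_derivative C (at X) \<eta> = 0}"

definition tangent_bundle :: "('a::real_normed_vector \<Rightarrow> 'b::real_normed_vector) \<Rightarrow> ('a \<times> 'a) set" where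
  "tangent_bundle C = {(X, \<eta>). X \<in> feasible_set C \<and> \<eta> \<in> tangent_space C X}"

(* T is the domain of r. For (X, 0) in T, the set of all \<eta> with (X, \<eta>) in T is a
   relatively open neighbourhood of 0 in the tangent space at X, so the derivative within it
   is the derivative on the tangent space. *)
definition retraction_around ::
  "('a::real_normed_vector \<Rightarrow> 'b::real_normed_vector) \<Rightarrow> 'a \<Rightarrow> ('a \<times> 'a) set \<Rightarrow> ('a \<times> 'a \<Rightarrow> 'a) \<Rightarrow> bool"
where
  "retraction_around C Xf T r \<longleftrightarrow>
     openin (top_of_set (tangent_bundle C)) T \<and>
     smooth_on T r \<and> r ` T \<subseteq> feasible_set C \<and>
     (\<exists>\<Omega> \<rho>. openin (top_of_set (feasible_set C)) \<Omega> \<and> Xf \<in> \<Omega> \<and> \<Omega> \<subseteq> r ` T \<and> \<rho> > 0 \<and>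
        (\<forall>X \<eta>. (X, \<eta>) \<in> tangent_bundle C \<and> X \<in> \<Omega> \<and> norm \<eta> < \<rho> \<longrightarrow> (X, \<eta>) \<in> T)) \<and>
     (\<forall>X. (X, 0) \<in> T \<longrightarrow>
        r (X, 0) = X \<and> ((\<lambda>\<eta>. r (X, \<eta>)) has_derivative (\<lambda>\<eta>. \<eta>)) (at 0 within {\<eta>. (X, \<eta>) \<in> T}))"

(* F' X is meant to be any derivative of F at X within the feasible set, for instance that of
   a smooth extension of F. It is determined only on tangent directions, and the second
   equation restricts \<eta> to these. *)
definition newton_system ::
  "('a::real_normed_vector \<Rightarrow> 'b::real_normed_vector) \<Rightarrow> ('a \<Rightarrow> 'a \<Rightarrow>\<^sub>L 'a) \<Rightarrow> ('a \<Rightarrow> 'a) \<Rightarrow> ('a \<Rightarrow> 'a \<Rightarrow> 'a)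
    \<Rightarrow> 'a \<Rightarrow> 'a \<Rightarrow> bool" where
  "newton_system C P F F' X \<eta> \<longleftrightarrow>
     blinfun_apply (P X) (F' X \<eta>) = - F X \<and> frechet_derivative C (at X) \<eta> = 0"

definition converges_quadratically :: "(nat \<Rightarrow> 'a::real_normed_vector) \<Rightarrow> 'a \<Rightarrow> bool" where
  "converges_quadratically X x \<longleftrightarrow>
     X \<longlonglongrightarrow> x \<and>
     (\<exists>M0. \<forall>\<^sub>F i in sequentially. norm (X (Suc i) - x) \<le> M0 * (norm (X i - x))\<^sup>2)"

end

theory Submission
  imports Defs
begin

text \<open>
  The iteration is Newton's method for \<open>F X = 0\<close>, \<open>C X = 0\<close>, followed by a retraction that brings
  the point back to the feasible set \<open>M\<close>.  The proof works entirely in the ambient space and uses no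
  charts of \<open>M\<close>.  Let \<open>G\<close> be a local smooth extension of \<open>F\<close>, put \<open>A X = (P X \<circ> G' X, C' X)\<close> and
  \<open>e = X - Xs\<close>.

  On tangent vectors at points of \<open>M\<close> near \<open>Xs\<close>, \<open>F' X\<close> agrees with \<open>G' X\<close>, because \<open>F' X\<close> is a
  derivative within \<open>M\<close> and every such tangent vector is the velocity of a curve \<open>t \<mapsto> r (X, t \<eta>)\<close> in
  \<open>M\<close> (\<open>retraction_curve\<close>, \<open>has_derivative_unique_along_curve\<close>); the retraction thus replaces the
  implicit function theorem.  Hence nondegeneracy says that \<open>A Xs\<close> is injective, and the bound
  \<open>c |v| \<le> |A X v|\<close> persists for all \<open>X \<in> M\<close> near \<open>Xs\<close> (\<open>joint_injectivity_stable\<close>).  The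
  tangent space and the range of \<open>P X\<close> have the same dimension (\<open>dim_kernel_of_surj\<close>), so an injective
  map between them is onto, and the Newton system, whose right-hand side \<open>- F X\<close> lies in that range,
  has exactly one solution \<open>\<eta>\<close>.

  Since \<open>P X\<close> fixes \<open>F X\<close>, and \<open>F\<close> and \<open>C\<close> vanish at \<open>Xs\<close>, the vector \<open>A X (e + \<eta>)\<close> has the components
  \<open>P X (F Xs - F X - G' X (Xs - X))\<close> and \<open>C Xs - C X - C' X (Xs - X)\<close>.  These are Taylor remainders,
  of size \<open>O(|e|\<^sup>2)\<close> by \<open>smooth_on_local_Taylor\<close>, so \<open>e + \<eta> = O(|e|\<^sup>2)\<close> and \<open>\<eta> = O(|e|)\<close>.  The
  retraction moves the point \<open>X + \<eta>\<close> only by \<open>O(|\<eta>|\<^sup>2)\<close>, uniformly in \<open>X\<close> (\<open>retraction_second_order\<close>),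
  and therefore \<open>r (X, \<eta>) - Xs = O(|e|\<^sup>2)\<close>, which \<open>quadratic_iteration\<close> turns into convergence.
\<close>

section \<open>Second-order Taylor bounds for smooth maps\<close>

text \<open>The directional derivatives of \<open>g\<close> along the finitely many basis vectors are continuous, hence
  bounded near \<open>x0\<close>, and their sum bounds the operator norm of the derivative.\<close>
lemma Ck_on_1_locally_Lipschitz:
  fixes g :: "'a::euclidean_space \<Rightarrow> 'b::real_normed_vector"
  assumes g: "Ck_on 1 U g" and U: "open U" "x0 \<in> U"
  obtains d L where "d > 0" "L \<ge> 0"
    "\<And>x y. x \<in> ball x0 d \<Longrightarrow> y \<in> ball x0 d \<Longrightarrow> norm (g x - g y) \<le> L * norm (x - y)"
proof -
  let ?g' = "\<lambda>x. frechet_derivative g (at x)"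
  have deriv: "(g has_derivative ?g' x) (at x)" if "x \<in> U" for x
    using g that by (simp add: frechet_derivative_works)
  have cont: "continuous_on U (\<lambda>x. norm (?g' x v))" for v
    using g by (intro continuous_intros) simp
  have bounded: "\<forall>\<^sub>F x in nhds x0. norm (?g' x b) < norm (?g' x0 b) + 1" for b
  proof -
    have "((\<lambda>x. norm (?g' x b)) \<longlongrightarrow> norm (?g' x0 b)) (nhds x0)"
      using cont[of b] U
        tendsto_at_iff_tendsto_nhds[of "\<lambda>x. norm (?g' x b)" x0]
      by (simp add: continuous_on_eq_continuous_at isCont_def)
    from order_tendstoD(2)[OF this] show ?thesis by simp
  qed
  have "\<forall>\<^sub>F x in nhds x0. x \<in> U \<and> (\<forall>b\<in>Basis. norm (?g' x b) < norm (?g' x0 b) + 1)"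
    using bounded U by (auto intro!: eventually_conj eventually_nhds_in_open
        simp: eventually_ball_finite_distrib)
  then obtain d where "d > 0" and d: "\<And>x. x \<in> ball x0 d \<Longrightarrow> x \<in> U"
      "\<And>x b. x \<in> ball x0 d \<Longrightarrow> b \<in> Basis \<Longrightarrow> norm (?g' x b) < norm (?g' x0 b) + 1"
    unfolding eventually_nhds_metric by (auto simp: dist_commute)
  define L where "L = (\<Sum>b\<in>Basis. norm (?g' x0 b) + 1)"
  have "L \<ge> 0" unfolding L_def by (intro sum_nonneg) auto
  have "onorm (?g' x) \<le> L" if x: "x \<in> ball x0 d" for x
  proof -
    have bl: "bounded_linear (?g' x)"
      using deriv[OF d(1)[OF x]] by (rule has_derivative_bounded_linear)
    have "onorm (?g' x) = norm (Blinfun (?g' x))"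
      using bl by (simp add: norm_blinfun.rep_eq bounded_linear_Blinfun_apply)
    also have "\<dots> \<le> (\<Sum>b\<in>Basis. norm (?g' x b))"
      using norm_blinfun_euclidean_le[of "Blinfun (?g' x)"] bl
      by (simp add: bounded_linear_Blinfun_apply)
    also have "\<dots> \<le> L" unfolding L_def using d(2)[OF x] by (intro sum_mono) fastforce
    finally show ?thesis .
  qed
  then have "norm (g x - g y) \<le> L * norm (x - y)" if "x \<in> ball x0 d" "y \<in> ball x0 d" for x y
    using that d(1) deriv
    by (intro differentiable_bound[where S = "ball x0 d" and f' = ?g'])
       (auto intro: has_derivative_at_withinI)
  then show ?thesis using that \<open>d > 0\<close> \<open>L \<ge> 0\<close> by blast
qed

text \<open>\<open>Ck_on\<close> only speaks of the directional derivatives of \<open>f\<close>.  As the domain is finite-dimensional,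
  the Lipschitz bounds for the basis directions combine to a Lipschitz bound for the derivative in
  operator norm, from which the quadratic remainder follows by the mean value inequality on a segment.\<close>
lemma Ck_on_2_local_Taylor:
  fixes f :: "'a::euclidean_space \<Rightarrow> 'b::real_normed_vector"
  assumes f: "Ck_on 2 U f" and U: "open U" "x0 \<in> U"
  obtains D :: "'a \<Rightarrow> 'a \<Rightarrow>\<^sub>L 'b" and d L where "d > 0" "L \<ge> 0" "ball x0 d \<subseteq> U"
    "\<And>x. x \<in> ball x0 d \<Longrightarrow> (f has_derivative blinfun_apply (D x)) (at x)"
    "isCont D x0"
    "\<And>x y. x \<in> ball x0 d \<Longrightarrow> y \<in> ball x0 d \<Longrightarrow>
       norm (f y - f x - D x (y - x)) \<le> L * (norm (y - x))\<^sup>2"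
proof -
  let ?f' = "\<lambda>x. frechet_derivative f (at x)"
  define D where "D x = Blinfun (?f' x)" for x
  have deriv: "(f has_derivative ?f' x) (at x)" if "x \<in> U" for x
    using f that by (simp add: numeral_2_eq_2 frechet_derivative_works)
  have D: "blinfun_apply (D x) = ?f' x" if "x \<in> U" for x
    using deriv[OF that] unfolding D_def
    by (intro bounded_linear_Blinfun_apply has_derivative_bounded_linear)
  have "Ck_on 1 U (\<lambda>x. ?f' x b)" for b
    using f by (simp add: numeral_2_eq_2)
  then have "\<exists>d L. d > 0 \<and> L \<ge> 0 \<and> (\<forall>x\<in>ball x0 d. \<forall>y\<in>ball x0 d.
      norm (?f' x b - ?f' y b) \<le> L * norm (x - y))" for b
    using Ck_on_1_locally_Lipschitz[OF _ U] by metis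
  then obtain e K where e: "\<And>b. e b > 0" and K: "\<And>b. K b \<ge> 0"
    and lip: "\<And>b x y. x \<in> ball x0 (e b) \<Longrightarrow> y \<in> ball x0 (e b) \<Longrightarrow>
      norm (?f' x b - ?f' y b) \<le> K b * norm (x - y)"
    by metis
  obtain d0 where d0: "d0 > 0" "ball x0 d0 \<subseteq> U"
    using U open_contains_ball by blast
  define d where "d = Min (insert d0 (e ` Basis))"
  have d: "d > 0" "d \<le> d0" "\<And>b. b \<in> Basis \<Longrightarrow> d \<le> e b"
    unfolding d_def using d0 e by (simp, simp, intro Min_le, auto)
  define L where "L = (\<Sum>b\<in>Basis. K b)"
  have "L \<ge> 0" unfolding L_def using K by (intro sum_nonneg)
  have dU: "ball x0 d \<subseteq> U" using d(2) d0(2) by (meson order_trans subset_ball)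
  have derivD: "(f has_derivative blinfun_apply (D x)) (at x)" if "x \<in> ball x0 d" for x
    using deriv[of x] D[of x] dU that by auto
  have Lip: "norm (D x - D y) \<le> L * norm (x - y)"
    if xy: "x \<in> ball x0 d" "y \<in> ball x0 d" for x y
  proof -
    have "norm (D x - D y) \<le> (\<Sum>b\<in>Basis. norm ((D x - D y) b))"
      by (rule norm_blinfun_euclidean_le)
    also have "\<dots> \<le> (\<Sum>b\<in>Basis. K b * norm (x - y))"
    proof (rule sum_mono)
      fix b :: 'a assume "b \<in> Basis"
      then have "ball x0 d \<subseteq> ball x0 (e b)" using d(3) by (intro subset_ball) auto
      then show "norm ((D x - D y) b) \<le> K b * norm (x - y)"
        using lip[of x b y] xy dU D by (auto simp: blinfun.diff_left subset_iff)
    qed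
    finally show ?thesis by (simp add: L_def sum_distrib_right)
  qed
  have "norm (f y - f x - D x (y - x)) \<le> L * (norm (y - x))\<^sup>2"
    if xy: "x \<in> ball x0 d" "y \<in> ball x0 d" for x y
  proof -
    have seg: "closed_segment x y \<subseteq> ball x0 d"
      using xy by (simp add: closed_segment_subset)
    (* the derivative D z - D x of ?h vanishes at x and is at most L |y - x| on the segment *)
    let ?h = "\<lambda>z. f z - D x z"
    have "norm (?h y - ?h x) \<le> (L * norm (y - x)) * norm (y - x)"
    proof (rule differentiable_bound[where S = "closed_segment x y"
            and f' = "\<lambda>z. blinfun_apply (D z - D x)"])
      fix z assume z: "z \<in> closed_segment x y"
      then have "(?h has_derivative (\<lambda>v. D z v - D x v)) (at z)"
        using derivD seg
        by (intro has_derivative_diff bounded_linear_imp_has_derivative blinfun.bounded_linear_right)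
           auto
      then show "(?h has_derivative blinfun_apply (D z - D x)) (at z within closed_segment x y)"
        by (simp add: blinfun.diff_left[abs_def] has_derivative_at_withinI minus_blinfun.rep_eq)
      have "norm (D z - D x) \<le> L * norm (z - x)"
        using Lip z seg xy by auto
      also have "\<dots> \<le> L * norm (y - x)"
        using z \<open>L \<ge> 0\<close> segment_bound(1)[OF z] by (intro mult_left_mono) auto
      finally show "onorm (blinfun_apply (D z - D x)) \<le> L * norm (y - x)"
        by (simp add: norm_blinfun.rep_eq)
    qed auto
    then show ?thesis
      by (simp add: blinfun.diff_right power2_eq_square algebra_simps)
  qed
  moreover have "isCont D x0"
  proof -
    have "L-lipschitz_on (ball x0 d) D"
      using Lip \<open>L \<ge> 0\<close> by (intro lipschitz_onI) (auto simp: dist_norm)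
    then have "continuous_on (ball x0 d) D" by (rule lipschitz_on_continuous_on)
    then show ?thesis using \<open>d > 0\<close> by (simp add: continuous_on_eq_continuous_at)
  qed
  ultimately show ?thesis using that \<open>d > 0\<close> \<open>L \<ge> 0\<close> dU derivD by blast
qed

text \<open>For a set \<open>S\<close> that is not open, the derivative \<open>D\<close> belongs to one fixed local extension \<open>g\<close>, so that
  the Taylor bound holds for all pairs of nearby points of \<open>S\<close>, even if the segment between them
  leaves \<open>S\<close>.\<close>
lemma smooth_on_local_Taylor:
  fixes f :: "'a::euclidean_space \<Rightarrow> 'b::real_normed_vector"
  assumes "smooth_on S f" "x0 \<in> S"
  obtains g and D :: "'a \<Rightarrow> 'a \<Rightarrow>\<^sub>L 'b" and d L where "d > 0" "L \<ge> 0"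
    "\<And>x. x \<in> S \<Longrightarrow> x \<in> ball x0 d \<Longrightarrow> g x = f x"
    "\<And>x. x \<in> ball x0 d \<Longrightarrow> (g has_derivative blinfun_apply (D x)) (at x)"
    "isCont D x0"
    "\<And>x y. x \<in> ball x0 d \<Longrightarrow> y \<in> ball x0 d \<Longrightarrow>
       norm (g y - g x - D x (y - x)) \<le> L * (norm (y - x))\<^sup>2"
proof -
  obtain U g where U: "open U" "x0 \<in> U" "Ck_on 2 U g" "\<And>y. y \<in> S \<inter> U \<Longrightarrow> g y = f y"
    using assms unfolding smooth_on_def by meson
  obtain D :: "'a \<Rightarrow> 'a \<Rightarrow>\<^sub>L 'b" and d L where *: "d > 0" "L \<ge> 0" "ball x0 d \<subseteq> U"
    "\<And>x. x \<in> ball x0 d \<Longrightarrow> (g has_derivative blinfun_apply (D x)) (at x)"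
    "isCont D x0"
    "\<And>x y. x \<in> ball x0 d \<Longrightarrow> y \<in> ball x0 d \<Longrightarrow>
       norm (g y - g x - D x (y - x)) \<le> L * (norm (y - x))\<^sup>2"
    by (rule Ck_on_2_local_Taylor[OF U(3,1,2)]) blast
  have "g x = f x" if "x \<in> S" "x \<in> ball x0 d" for x
    using U(4) that *(3) by blast
  then show ?thesis using that * by blast
qed

lemma smooth_on_imp_continuous_within:
  fixes f :: "'a::euclidean_space \<Rightarrow> 'b::real_normed_vector"
  assumes "smooth_on S f" "x \<in> S"
  shows "continuous (at x within S) f"
proof -
  obtain g and D :: "'a \<Rightarrow> 'a \<Rightarrow>\<^sub>L 'b" and d where d: "d > 0"
    "\<And>y. y \<in> S \<Longrightarrow> y \<in> ball x d \<Longrightarrow> g y = f y"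
    "\<And>y. y \<in> ball x d \<Longrightarrow> (g has_derivative blinfun_apply (D y)) (at y)"
    using smooth_on_local_Taylor[OF assms] by metis
  then have "continuous (at x within S) g"
    by (meson centre_in_ball continuous_at_imp_continuous_at_within has_derivative_continuous)
  then show ?thesis
    using d(1,2) assms(2)
    by (rule_tac continuous_transform_within[of x S g d]) (auto simp: dist_commute)
qed

section \<open>Injectivity and dimension\<close>

text \<open>Injectivity gives a lower bound by compactness of the unit sphere of the domain, and a small change
  in operator norm costs at most half of it.  In the Newton system, \<open>S\<close> is the projected
  derivative of \<open>F\<close> and \<open>J\<close> that of the constraint.\<close>
lemma joint_injectivity_stable:
  fixes S :: "'x::metric_space \<Rightarrow> 'a::euclidean_space \<Rightarrow>\<^sub>L 'b::real_normed_vector"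
    and J :: "'x \<Rightarrow> 'a \<Rightarrow>\<^sub>L 'c::real_normed_vector"
  assumes S: "continuous (at x within M) S" and J: "continuous (at x within M) J"
    and inj: "\<And>v. S x v = 0 \<Longrightarrow> J x v = 0 \<Longrightarrow> v = 0"
  obtains c d where "c > 0" "d > 0"
    "\<And>y v. y \<in> M \<Longrightarrow> dist y x < d \<Longrightarrow> c * norm v \<le> norm (S y v) + norm (J y v)"
proof -
  let ?N = "\<lambda>y v. norm (S y v) + norm (J y v)"
  obtain c where "c > 0" and c: "\<And>v. c * norm v \<le> ?N x v"
  proof -
    let ?s = "sphere (0::'a) 1"
    have "continuous_on ?s (?N x)" by (intro continuous_intros)
    then obtain u where u: "u \<in> ?s" "\<And>w. w \<in> ?s \<Longrightarrow> ?N x u \<le> ?N x w"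
      using continuous_attains_inf[of ?s "?N x"] by (auto simp: compact_sphere)
    have "?N x u > 0"
    proof -
      have "u \<noteq> 0" using u(1) by auto
      then have "S x u \<noteq> 0 \<or> J x u \<noteq> 0" using inj by blast
      then show ?thesis by (auto intro: add_pos_nonneg add_nonneg_pos)
    qed
    moreover have "?N x u * norm v \<le> ?N x v" for v
    proof (cases "v = 0")
      case False
      let ?w = "inverse (norm v) *\<^sub>R v"
      have "?N x u * norm v \<le> ?N x ?w * norm v"
        using False by (intro mult_right_mono u(2)) auto
      also have "\<dots> = ?N x v"
        using False by (simp add: blinfun.scaleR_right field_simps)
      finally show ?thesis .
    qed simp
    ultimately show ?thesis using that by blast
  qed
  have "c / 4 > 0" using \<open>c > 0\<close> by simp
  have near: "\<exists>d>0. \<forall>y\<in>M. dist y x < d \<longrightarrow> dist (A y) (A x) < c / 4"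
    if "continuous (at x within M) A" for A :: "'x \<Rightarrow> 'a \<Rightarrow>\<^sub>L 'z::real_normed_vector"
    using that \<open>c / 4 > 0\<close> unfolding continuous_within_eps_delta by blast
  obtain d1 where d1: "d1 > 0" "\<And>y. y \<in> M \<Longrightarrow> dist y x < d1 \<Longrightarrow> dist (S y) (S x) < c / 4"
    using near[OF S] by blast
  obtain d2 where d2: "d2 > 0" "\<And>y. y \<in> M \<Longrightarrow> dist y x < d2 \<Longrightarrow> dist (J y) (J x) < c / 4"
    using near[OF J] by blast
  have "c / 2 * norm v \<le> ?N y v" if y: "y \<in> M" "dist y x < min d1 d2" for y v
  proof -
    have pert: "norm (B v) \<le> norm (A v) + c / 4 * norm v" if "dist A B < c / 4"
      for A B :: "'a \<Rightarrow>\<^sub>L 'z::real_normed_vector"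
    proof -
      have "norm (B v) \<le> norm (A v) + norm ((A - B) v)"
        using norm_triangle_ineq4[of "A v" "(A - B) v"] by (simp add: blinfun.diff_left)
      also have "norm ((A - B) v) \<le> norm (A - B) * norm v" by (rule norm_blinfun)
      also have "\<dots> \<le> c / 4 * norm v"
        using that by (intro mult_right_mono) (auto simp: dist_norm)
      finally show ?thesis by simp
    qed
    have "norm (S x v) \<le> norm (S y v) + c / 4 * norm v" "norm (J x v) \<le> norm (J y v) + c / 4 * norm v"
      using d1(2) d2(2) y by (intro pert; simp)+
    then show ?thesis using c[of v] by simp
  qed
  then show ?thesis using that[of "c / 2" "min d1 d2"] \<open>c > 0\<close> d1(1) d2(1) by auto
qed

text \<open>The map \<open>f\<close> restricts to a bijection from the orthogonal complement of its kernel onto the codomain.\<close>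
lemma dim_kernel_of_surj:
  fixes f :: "'a::euclidean_space \<Rightarrow> 'b::real_vector"
  assumes f: "linear f" "surj f"
  shows "dim {x. f x = 0} + dim (UNIV :: 'b set) = DIM('a)"
proof -
  let ?K = "{x. f x = 0}"
  let ?W = "{y. \<forall>x\<in>?K. orthogonal x y}"
  have K: "subspace ?K" using f(1) by (auto simp: subspace_def linear_0 linear_add linear_scale)
  have W: "subspace ?W"
    by (auto simp: subspace_def orthogonal_clauses)
  have "dim ?W + dim ?K = DIM('a)"
    using dim_subspace_orthogonal_to_vectors[OF K subspace_UNIV] by simp
  moreover have "dim (f ` ?W) = dim ?W"
  proof (rule dim_image_eq[OF f(1)])
    have "x = 0" if "x \<in> ?W" "f x = 0" for x
      using that by (auto simp: orthogonal_self)
    then show "inj_on f (span ?W)"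
      using W f(1) by (simp add: linear_injective_on_subspace_0 span_eq_iff[THEN iffD2])
  qed
  moreover have "f ` ?W = UNIV"
  proof -
    have "z \<in> f ` ?W" for z
    proof -
      obtain x where x: "f x = z" using f(2) by (metis surjD)
      obtain y w where "y \<in> span ?K" "\<And>k. k \<in> span ?K \<Longrightarrow> orthogonal w k" "x = y + w"
        by (rule orthogonal_subspace_decomp_exists[of ?K x]) blast
      then have "f y = 0" "w \<in> ?W" "f x = f y + f w"
        using K f(1) by (auto simp: span_eq_iff[THEN iffD2] orthogonal_commute linear_add)
      then show ?thesis using x by auto
    qed
    then show ?thesis by auto
  qed
  ultimately show ?thesis by simp
qed

section \<open>Retractions\<close>

text \<open>A derivative within \<open>M\<close> is in general not unique, but its value at the velocity of a curve in \<open>M\<close>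
  is, by the chain rule.\<close>
lemma has_derivative_unique_along_curve:
  fixes \<gamma> :: "real \<Rightarrow> 'a::real_normed_vector" and f :: "'a \<Rightarrow> 'b::real_normed_vector"
  assumes \<gamma>: "(\<gamma> has_derivative (\<lambda>t. t *\<^sub>R v)) (at 0)" and S: "open S" "0 \<in> S" "\<gamma> ` S \<subseteq> M"
    and A: "(f has_derivative A) (at (\<gamma> 0) within M)"
    and B: "(f has_derivative B) (at (\<gamma> 0) within M)"
  shows "A v = B v"
proof -
  have "((\<lambda>t. f (\<gamma> t)) has_derivative (\<lambda>t. D (t *\<^sub>R v))) (at 0)"
    if "(f has_derivative D) (at (\<gamma> 0) within M)" for D
  proof -
    have "((\<lambda>t. f (\<gamma> t)) has_derivative (\<lambda>t. D (t *\<^sub>R v))) (at 0 within S)"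
      using has_derivative_in_compose[OF has_derivative_at_withinI[OF \<gamma>]
          has_derivative_subset[OF that S(3)]] .
    then show ?thesis unfolding at_within_open[OF S(2,1)] .
  qed
  from fun_cong[OF has_derivative_unique[OF this[OF A] this[OF B]], of 1] show ?thesis by simp
qed

text \<open>As \<open>T\<close> is relatively open in the tangent bundle, the ray through \<open>\<eta>\<close> stays in it for small \<open>t\<close>.  The
  retraction maps this piece of the ray to a curve in the feasible set, so every tangent vector at
  \<open>X\<close> is the velocity of such a curve.\<close>
lemma retraction_curve:
  fixes C :: "'a::euclidean_space \<Rightarrow> 'b::real_normed_vector"
  assumes retr: "retraction_around C Xf T r" and X0: "(X, 0) \<in> T"
    and lin: "linear (frechet_derivative C (at X))" and \<eta>: "\<eta> \<in> tangent_space C X"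
  obtains S where "open S" "0 \<in> S" "\<And>t. t \<in> S \<Longrightarrow> (X, t *\<^sub>R \<eta>) \<in> T"
    "((\<lambda>t. r (X, t *\<^sub>R \<eta>)) has_derivative (\<lambda>t. t *\<^sub>R \<eta>)) (at 0)"
proof -
  obtain O' where O': "open O'" "T = tangent_bundle C \<inter> O'"
    using retr unfolding retraction_around_def openin_open by blast
  define S where "S = {t. (X, t *\<^sub>R \<eta>) \<in> O'}"
  have "open S"
    unfolding S_def using O'(1) open_vimage[of O' "\<lambda>t. (X, t *\<^sub>R \<eta>)"]
    by (simp add: vimage_def continuous_intros)
  have "0 \<in> S" using X0 O' by (simp add: S_def)
  have T: "(X, t *\<^sub>R \<eta>) \<in> T" if "t \<in> S" for t
    using that X0 \<eta> O' lin
    by (auto simp: S_def tangent_bundle_def tangent_space_def linear_scale)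
  have "((\<lambda>\<eta>. r (X, \<eta>)) has_derivative (\<lambda>\<eta>. \<eta>)) (at 0 within {\<eta>. (X, \<eta>) \<in> T})"
    using retr X0 unfolding retraction_around_def by blast
  then have "((\<lambda>\<eta>. r (X, \<eta>)) has_derivative (\<lambda>\<eta>. \<eta>)) (at (0 *\<^sub>R \<eta>) within (\<lambda>t. t *\<^sub>R \<eta>) ` S)"
    unfolding scale_zero_left by (rule has_derivative_subset) (use T in auto)
  then have "((\<lambda>t. r (X, t *\<^sub>R \<eta>)) has_derivative (\<lambda>t. t *\<^sub>R \<eta>)) (at 0 within S)"
    by (intro has_derivative_in_compose[where f = "\<lambda>t. t *\<^sub>R \<eta>" and g = "\<lambda>\<eta>. r (X, \<eta>)"])
       (auto intro!: derivative_eq_intros)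
  then show ?thesis
    unfolding at_within_open[OF \<open>0 \<in> S\<close> \<open>open S\<close>] using that \<open>open S\<close> \<open>0 \<in> S\<close> T by blast
qed

text \<open>For a single \<open>X\<close>, the derivative of \<open>\<eta> \<mapsto> r (X, \<eta>)\<close> at \<open>0\<close> gives only \<open>r (X, \<eta>) = X + \<eta> + o(|\<eta>|)\<close>.
  That the remainder is quadratic, with a constant that does not depend on \<open>X\<close>, comes from the joint
  smoothness of \<open>r\<close> in both arguments near \<open>(Xf, 0)\<close>.\<close>
lemma retraction_second_order:
  fixes C :: "'a::euclidean_space \<Rightarrow> 'b::real_normed_vector"
  assumes retr: "retraction_around C Xf T r" and Xf: "Xf \<in> feasible_set C"
    and lin: "\<And>X. linear (frechet_derivative C (at X))"
  obtains d K where "d > 0" "K \<ge> 0"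
    "\<And>X \<eta>. X \<in> feasible_set C \<Longrightarrow> \<eta> \<in> tangent_space C X \<Longrightarrow> norm (X - Xf) < d \<Longrightarrow> norm \<eta> < d \<Longrightarrow>
      (X, \<eta>) \<in> T \<and> norm (r (X, \<eta>) - (X + \<eta>)) \<le> K * (norm \<eta>)\<^sup>2"
proof -
  obtain \<Omega> \<rho> where \<Omega>: "openin (top_of_set (feasible_set C)) \<Omega>" "Xf \<in> \<Omega>" and "\<rho> > 0"
    and \<rho>: "\<And>X \<eta>. (X, \<eta>) \<in> tangent_bundle C \<Longrightarrow> X \<in> \<Omega> \<Longrightarrow> norm \<eta> < \<rho> \<Longrightarrow> (X, \<eta>) \<in> T"
    using retr unfolding retraction_around_def by blast
  obtain e where e: "e > 0" "\<And>X. X \<in> feasible_set C \<Longrightarrow> norm (X - Xf) < e \<Longrightarrow> X \<in> \<Omega>"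
    using \<Omega> unfolding openin_euclidean_subtopology_iff by (auto simp: dist_norm)
  have T: "(X, \<eta>) \<in> T" if "X \<in> feasible_set C" "\<eta> \<in> tangent_space C X"
    "norm (X - Xf) < e" "norm \<eta> < \<rho>" for X \<eta>
    using that by (intro \<rho> e(2)) (auto simp: tangent_bundle_def)
  have zero: "0 \<in> tangent_space C X" for X
    using lin by (simp add: tangent_space_def linear_0)
  have T0: "(X, 0) \<in> T" if "X \<in> feasible_set C" "norm (X - Xf) < e" for X
    using T[OF that(1) zero that(2)] \<open>\<rho> > 0\<close> by simp
  have "smooth_on T r" using retr by (simp add: retraction_around_def)
  moreover have "(Xf, 0) \<in> T" using T0[OF Xf] e(1) by simp
  ultimately obtain R and D :: "'a \<times> 'a \<Rightarrow> ('a \<times> 'a) \<Rightarrow>\<^sub>L 'a" and dR L where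
    "dR > 0" "L \<ge> 0"
    and R: "\<And>p. p \<in> T \<Longrightarrow> p \<in> ball (Xf, 0) dR \<Longrightarrow> R p = r p"
      "\<And>p. p \<in> ball (Xf, 0) dR \<Longrightarrow> (R has_derivative blinfun_apply (D p)) (at p)"
    and Taylor: "\<And>p q. p \<in> ball (Xf, 0) dR \<Longrightarrow> q \<in> ball (Xf, 0) dR \<Longrightarrow>
       norm (R q - R p - D p (q - p)) \<le> L * (norm (q - p))\<^sup>2"
    by (rule smooth_on_local_Taylor) blast
  (* the factor 1/2 makes the sum of the norms of both components of (X - Xf, \<eta>) less than dR *)
  define d where "d = min (min e \<rho>) (dR / 2)"
  have "d > 0" using e \<open>\<rho> > 0\<close> \<open>dR > 0\<close> by (simp add: d_def)
  have ball: "(X, \<eta>) \<in> ball (Xf, 0) dR" if "norm (X - Xf) < d" "norm \<eta> < d" for X \<eta> :: 'a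
  proof -
    have "norm ((X, \<eta>) - (Xf, 0)) < dR"
      using that norm_Pair_le[of "X - Xf" \<eta>] by (simp add: d_def)
    then show ?thesis by (metis dist_commute dist_norm mem_ball)
  qed
  have "(X, \<eta>) \<in> T \<and> norm (r (X, \<eta>) - (X + \<eta>)) \<le> L * (norm \<eta>)\<^sup>2"
    if X: "X \<in> feasible_set C" "norm (X - Xf) < d" and \<eta>: "\<eta> \<in> tangent_space C X" "norm \<eta> < d"
    for X \<eta>
  proof -
    have X0: "(X, 0) \<in> T" using T0 X by (simp add: d_def)
    have X\<eta>: "(X, \<eta>) \<in> T" using T X \<eta> by (simp add: d_def)
    have "(X, 0 :: 'a) \<in> ball (Xf, 0) dR"
      by (rule ball[OF X(2)]) (simp add: \<open>d > 0\<close>)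
    note b = this ball[OF X(2) \<eta>(2)]
    (* D is the derivative of an extension R of r; both have the same derivative along the curve
       t \<mapsto> (X, t \<eta>), which stays in T for small t *)
    have "D (X, 0) (0, \<eta>) = \<eta>"
    proof -
      obtain S where S: "open S" "0 \<in> S" "\<And>t. t \<in> S \<Longrightarrow> (X, t *\<^sub>R \<eta>) \<in> T"
        and r': "((\<lambda>t. r (X, t *\<^sub>R \<eta>)) has_derivative (\<lambda>t. t *\<^sub>R \<eta>)) (at 0)"
        using retraction_curve[OF retr X0 lin \<eta>(1)] by blast
      let ?S = "S \<inter> (\<lambda>t. (X, t *\<^sub>R \<eta>)) -` ball (Xf, 0) dR"
      have "open ?S" 
        by (intro open_Int[OF S(1)] open_vimage open_ball continuous_on_Pair continuous_on_const
            continuous_on_scaleR continuous_on_id)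
      have "((\<lambda>t. (X, t *\<^sub>R \<eta>)) has_derivative (\<lambda>t. (0, t *\<^sub>R \<eta>))) (at 0)"
        by (auto intro!: derivative_eq_intros)
      from has_derivative_compose[OF this, of R "D (X, 0)"]
      have "((\<lambda>t. R (X, t *\<^sub>R \<eta>)) has_derivative (\<lambda>t. D (X, 0) (0, t *\<^sub>R \<eta>))) (at 0)"
        using R(2)[OF b(1)] by simp
      then have "((\<lambda>t. r (X, t *\<^sub>R \<eta>)) has_derivative (\<lambda>t. D (X, 0) (0, t *\<^sub>R \<eta>))) (at 0)"
        by (rule has_derivative_transform_within_open[OF _ \<open>open ?S\<close>])
           (use S(2,3) b(1) R(1) in simp_all)
      from fun_cong[OF has_derivative_unique[OF this r'], of 1] show ?thesis by simp
    qed
    moreover have "r (X, 0) = X" using retr X0 by (simp add: retraction_around_def)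
    ultimately show ?thesis
      using Taylor[OF b] R(1)[OF X0 b(1)] R(1)[OF X\<eta> b(2)] X\<eta>
      by (simp add: norm_Pair diff_diff_eq)
  qed
  then show ?thesis using that \<open>d > 0\<close> \<open>L \<ge> 0\<close> by blast
qed

section \<open>Quadratic convergence of the Newton iteration\<close>

text \<open>The quadratic estimate is known only near \<open>x\<close>.  It contracts distances on a smaller ball, so iterates
  that start there stay in the region where it applies.\<close>
lemma quadratic_iteration:
  fixes x :: "'a::real_normed_vector" and step :: "'a \<Rightarrow> 'a"
  assumes "d > 0"
    and quad: "\<And>y. y \<in> M \<Longrightarrow> norm (y - x) < d \<Longrightarrow>
      step y \<in> M \<and> norm (step y - x) \<le> K * (norm (y - x))\<^sup>2"
  obtains \<delta> where "\<delta> > 0" "\<delta> \<le> d"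
    "\<And>y. y \<in> M \<Longrightarrow> norm (y - x) < \<delta> \<Longrightarrow>
      (\<forall>i. (step ^^ i) y \<in> M \<and> norm ((step ^^ i) y - x) < \<delta>) \<and>
      converges_quadratically (\<lambda>i. (step ^^ i) y) x"
proof -
  (* for K \<delta> \<le> 1/2 each step at least halves the distance, so the iterates cannot leave the ball *)
  define \<delta> where "\<delta> = min d (1 / (2 * (\<bar>K\<bar> + 1)))"
  have \<delta>: "\<delta> > 0" "\<delta> \<le> d" using \<open>d > 0\<close> by (auto simp: \<delta>_def)
  have "\<bar>K\<bar> * \<delta> \<le> \<bar>K\<bar> * (1 / (2 * (\<bar>K\<bar> + 1)))"
    unfolding \<delta>_def by (intro mult_left_mono) auto
  also have "\<dots> \<le> 1 / 2" by (simp add: field_simps)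
  finally have K\<delta>: "\<bar>K\<bar> * \<delta> \<le> 1 / 2" .
  have half: "norm (step y - x) \<le> norm (y - x) / 2" if y: "y \<in> M" "norm (y - x) < \<delta>" for y
  proof -
    have "norm (step y - x) \<le> K * (norm (y - x))\<^sup>2" using quad[OF y(1)] y(2) \<delta> by simp
    also have "\<dots> \<le> \<bar>K\<bar> * norm (y - x) * norm (y - x)"
      by (simp add: power2_eq_square mult.assoc mult_right_mono)
    also have "\<dots> \<le> \<bar>K\<bar> * \<delta> * norm (y - x)"
      using y(2) by (intro mult_right_mono mult_left_mono) auto
    also have "\<dots> \<le> 1 / 2 * norm (y - x)" using K\<delta> by (intro mult_right_mono) auto
    finally show ?thesis by simp
  qed
  show ?thesis
  proof (rule that[OF \<delta>], intro conjI)
    fix y assume y: "y \<in> M" "norm (y - x) < \<delta>"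
    let ?X = "\<lambda>i. (step ^^ i) y"
    have X: "?X i \<in> M \<and> norm (?X i - x) \<le> norm (y - x) * (1 / 2) ^ i \<and> norm (?X i - x) < \<delta>" for i
    proof (induction i)
      case (Suc i)
      then have "?X (Suc i) \<in> M" "norm (?X (Suc i) - x) \<le> norm (?X i - x) / 2"
        using quad[of "?X i"] half[of "?X i"] \<delta> by auto
      moreover have "norm (?X i - x) / 2 \<le> norm (?X i - x)" by simp
      moreover have "norm (?X i - x) / 2 \<le> norm (y - x) * (1 / 2) ^ Suc i" using Suc by simp
      ultimately show ?case using Suc by linarith
    qed (use y in auto)
    then show "\<forall>i. ?X i \<in> M \<and> norm (?X i - x) < \<delta>" by blast
    have "(\<lambda>i. norm (y - x) * (1 / 2) ^ i) \<longlonglongrightarrow> norm (y - x) * 0"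
      by (intro tendsto_intros LIMSEQ_power_zero) auto
    then have "(\<lambda>i. ?X i - x) \<longlonglongrightarrow> 0"
      using X by (intro Lim_null_comparison[of "\<lambda>i. ?X i - x", OF always_eventually]) auto
    then have "?X \<longlonglongrightarrow> x" by (simp add: LIM_zero_iff)
    moreover have "\<forall>i. norm (?X (Suc i) - x) \<le> K * (norm (?X i - x))\<^sup>2"
    proof
      fix i
      have "?X i \<in> M" "norm (?X i - x) < d" using X[of i] \<delta>(2) by linarith+
      then show "norm (?X (Suc i) - x) \<le> K * (norm (?X i - x))\<^sup>2" using quad by simp
    qed
    ultimately show "converges_quadratically ?X x"
      unfolding converges_quadratically_def by (auto intro!: exI[of _ K])
  qed
qed

theorem claim1:
  fixes C :: "'a::euclidean_space \<Rightarrow> 'b::real_inner"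
    and P :: "'a \<Rightarrow> 'a \<Rightarrow>\<^sub>L 'a"
    and F :: "'a \<Rightarrow> 'a"
    and F' :: "'a \<Rightarrow> 'a \<Rightarrow> 'a"
    and r :: "'a \<times> 'a \<Rightarrow> 'a"
    and T :: "('a \<times> 'a) set"
    and M :: "'a set"
    and Xs :: 'a
  defines "M \<equiv> feasible_set C"
  assumes finite_dim: "\<exists>B :: 'b set. finite B \<and> span B = UNIV"
    and C_smooth: "smooth_on UNIV C"
    and full_rank: "\<And>X. X \<in> M \<Longrightarrow> surj (frechet_derivative C (at X))"
    and P_smooth: "smooth_on M P"
    and P_proj: "\<And>X. X \<in> M \<Longrightarrow> P X o\<^sub>L P X = P X"
    and P_rank: "\<And>X. X \<in> M \<Longrightarrow>
        int (dim (range (blinfun_apply (P X)))) = int DIM('a) - int (dim (UNIV :: 'b set))"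
    and F_smooth: "smooth_on M F"
    and F_deriv: "\<And>X. X \<in> M \<Longrightarrow> (F has_derivative F' X) (at X within M)"
    and PF: "\<And>X. X \<in> M \<Longrightarrow> blinfun_apply (P X) (F X) = F X"
    and Xs_feasible: "Xs \<in> M"
    and Xs_solution: "F Xs = 0"
    and retr: "retraction_around C Xs T r"
    and nondegenerate:
      "bij_betw (\<lambda>\<eta>. blinfun_apply (P Xs) (F' Xs \<eta>))
         (tangent_space C Xs) (range (blinfun_apply (P Xs)))"
  shows "\<exists>\<delta>>0. \<forall>X0\<in>M. norm (X0 - Xs) < \<delta> \<longrightarrow>
           (\<exists>X \<eta>. X 0 = X0 \<and>
              (\<forall>i::nat. X i \<in> M \<and>
                 (\<forall>\<zeta>. newton_system C P F F' (X i) \<zeta> \<longleftrightarrow> \<zeta> = \<eta> i) \<and>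
                 (X i, \<eta> i) \<in> T \<and>
                 X (Suc i) = r (X i, \<eta> i)) \<and>
              converges_quadratically X Xs)"
proof -
  note M_def = assms(1)
  let ?C' = "\<lambda>X. frechet_derivative C (at X)"
  have C_deriv: "(C has_derivative ?C' X) (at X)" for X
  proof -
    obtain g and D :: "'a \<Rightarrow> 'a \<Rightarrow>\<^sub>L 'b" and d where d: "d > 0"
      "\<And>x. x \<in> ball X d \<Longrightarrow> g x = C x"
      "\<And>x. x \<in> ball X d \<Longrightarrow> (g has_derivative blinfun_apply (D x)) (at x)"
      using smooth_on_local_Taylor[OF C_smooth UNIV_I, of X] by (metis UNIV_I)
    have X: "X \<in> ball X d" using d(1) by simp
    have "(C has_derivative blinfun_apply (D X)) (at X)"
      by (rule has_derivative_transform_within_open[OF d(3)[OF X] open_ball X]) (simp add: d(2))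
    then show ?thesis using frechet_derivative_at by metis
  qed
  have lin: "linear (?C' X)" for X
    using C_deriv has_derivative_linear by blast
  have tangent: "subspace (tangent_space C X)" for X
    unfolding tangent_space_def using lin[of X]
    by (auto simp: subspace_def linear_0 linear_add linear_scale)
  have dim_tangent: "dim (range (P X)) = dim (tangent_space C X)" if "X \<in> M" for X
    using dim_kernel_of_surj[OF lin full_rank[OF that]] P_rank[OF that]
    unfolding tangent_space_def by linarith

  obtain dr Kr where "dr > 0" "Kr \<ge> 0"
    and retr2: "\<And>X \<eta>. X \<in> M \<Longrightarrow> \<eta> \<in> tangent_space C X \<Longrightarrow> norm (X - Xs) < dr \<Longrightarrow> norm \<eta> < dr \<Longrightarrow>
      (X, \<eta>) \<in> T \<and> norm (r (X, \<eta>) - (X + \<eta>)) \<le> Kr * (norm \<eta>)\<^sup>2"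
    using retraction_second_order[OF retr _ lin] Xs_feasible unfolding M_def by metis
  have r_feasible: "r p \<in> M" if "p \<in> T" for p
    using retr that unfolding retraction_around_def M_def by blast

  obtain G and DF :: "'a \<Rightarrow> 'a \<Rightarrow>\<^sub>L 'a" and dF LF where "dF > 0" "LF \<ge> 0"
    and G: "\<And>X. X \<in> M \<Longrightarrow> X \<in> ball Xs dF \<Longrightarrow> G X = F X"
      "\<And>X. X \<in> ball Xs dF \<Longrightarrow> (G has_derivative blinfun_apply (DF X)) (at X)"
    and DF_cont: "isCont DF Xs"
    and G_Taylor: "\<And>X Y. X \<in> ball Xs dF \<Longrightarrow> Y \<in> ball Xs dF \<Longrightarrow>
       norm (G Y - G X - DF X (Y - X)) \<le> LF * (norm (Y - X))\<^sup>2"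
    by (rule smooth_on_local_Taylor[OF F_smooth Xs_feasible]) blast
  obtain H and DC :: "'a \<Rightarrow> 'a \<Rightarrow>\<^sub>L 'b" and dC LC where "dC > 0" "LC \<ge> 0"
    and H: "\<And>X. X \<in> ball Xs dC \<Longrightarrow> H X = C X"
      "\<And>X. X \<in> ball Xs dC \<Longrightarrow> (H has_derivative blinfun_apply (DC X)) (at X)"
    and DC_cont: "isCont DC Xs"
    and H_Taylor: "\<And>X Y. X \<in> ball Xs dC \<Longrightarrow> Y \<in> ball Xs dC \<Longrightarrow>
       norm (H Y - H X - DC X (Y - X)) \<le> LC * (norm (Y - X))\<^sup>2"
    using smooth_on_local_Taylor[OF C_smooth UNIV_I, of Xs] by (metis UNIV_I)
  have DC: "blinfun_apply (DC X) = ?C' X" if "X \<in> ball Xs dC" for X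
  proof (rule frechet_derivative_at)
    show "(C has_derivative DC X) (at X)"
      by (rule has_derivative_transform_within_open[OF H(2)[OF that] open_ball that])
         (simp add: H(1))
  qed

  (* F = G on M near Xs, so F has both F' X and DF X as derivatives within M *)
  have F'_tangent: "F' X \<eta> = DF X \<eta>"
    if X: "X \<in> M" "norm (X - Xs) < min dF dr" and \<eta>: "\<eta> \<in> tangent_space C X" for X \<eta>
  proof -
    have X0: "(X, 0) \<in> T"
      using retr2[OF X(1)] X(2) tangent[of X] \<open>dr > 0\<close> by (simp add: subspace_0)
    then have rX: "r (X, 0 *\<^sub>R \<eta>) = X" using retr by (simp add: retraction_around_def)
    have "X \<in> ball Xs dF" using X(2) by (simp add: dist_norm norm_minus_commute)
    then have "(F has_derivative DF X) (at X within M)"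
      using has_derivative_transform_within[OF has_derivative_at_withinI[OF G(2)], of X "dF - dist X Xs" M F]
        X(1) G(1) dist_triangle_less_add[of _ X "dF - dist X Xs" Xs "dist X Xs"]
      by (smt (verit) dist_commute dist_triangle mem_ball)
    moreover obtain S where S: "open S" "0 \<in> S" "\<And>t. t \<in> S \<Longrightarrow> (X, t *\<^sub>R \<eta>) \<in> T"
      "((\<lambda>t. r (X, t *\<^sub>R \<eta>)) has_derivative (\<lambda>t. t *\<^sub>R \<eta>)) (at 0)"
      using retraction_curve[OF retr X0 lin \<eta>] by blast
    moreover have "(\<lambda>t. r (X, t *\<^sub>R \<eta>)) ` S \<subseteq> M" using S(3) r_feasible by blast
    ultimately show ?thesis
      using F_deriv[OF X(1)] rX
      by (intro has_derivative_unique_along_curve[where \<gamma> = "\<lambda>t. r (X, t *\<^sub>R \<eta>)"]) auto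
  qed

  have P_cont: "continuous (at Xs within M) P"
    using smooth_on_imp_continuous_within[OF P_smooth Xs_feasible] .
  obtain dP where "dP > 0"
    and dP: "\<And>X. X \<in> M \<Longrightarrow> dist X Xs < dP \<Longrightarrow> dist (P X) (P Xs) < 1"
    using P_cont unfolding continuous_within_eps_delta by (meson zero_less_one)
  define p where "p = norm (P Xs) + 1"
  have P_bound: "norm (P X v) \<le> p * norm v" if X: "X \<in> M" "norm (X - Xs) < dP" for X v
  proof -
    have "norm (P X) \<le> p"
      using dP[OF X(1)] X(2) norm_triangle_sub[of "P X" "P Xs"] by (simp add: dist_norm p_def)
    then show ?thesis
      using norm_blinfun[of "P X" v] by (meson mult_right_mono norm_ge_zero order_trans)
  qed

  have inj_Xs: "v = 0" if v: "(P Xs o\<^sub>L DF Xs) v = 0" "DC Xs v = 0" for v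
  proof -
    have "v \<in> tangent_space C Xs"
      using v(2) DC[of Xs] \<open>dC > 0\<close> by (simp add: tangent_space_def)
    moreover have "0 \<in> tangent_space C Xs"
      using tangent[of Xs] by (rule subspace_0)
    moreover have "P Xs (F' Xs w) = P Xs (DF Xs w)" if "w \<in> tangent_space C Xs" for w
      using F'_tangent[OF Xs_feasible _ that] \<open>dF > 0\<close> \<open>dr > 0\<close> by simp
    ultimately show ?thesis
      using v(1) nondegenerate unfolding bij_betw_def inj_on_def by auto
  qed
  have "continuous (at Xs within M) (\<lambda>X. P X o\<^sub>L DF X)"
    using P_cont DF_cont
    by (auto simp: continuous_within intro!: bounded_bilinear.tendsto[OF bounded_bilinear_blinfun_compose]
        elim: tendsto_within_subset)
  moreover have "continuous (at Xs within M) DC"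
    using DC_cont by (rule continuous_at_imp_continuous_at_within)
  ultimately obtain c d1 where "c > 0" "d1 > 0"
    and below: "\<And>X v. X \<in> M \<Longrightarrow> dist X Xs < d1 \<Longrightarrow>
      c * norm v \<le> norm ((P X o\<^sub>L DF X) v) + norm (DC X v)"
    using joint_injectivity_stable[where S = "\<lambda>X. P X o\<^sub>L DF X", OF _ _ inj_Xs] by blast

  (* Q bounds |X - Xs + \<eta>| / |X - Xs|^2: the Taylor constants of F (passed through P) and of C,
     divided by the lower bound c.  As d \<le> 1, this gives |\<eta>| \<le> (1 + Q) |X - Xs|, and the last
     entry of the minimum keeps \<eta> in the domain of the retraction. *)
  define Q where "Q = (p * LF + LC) / c"
  have "p > 0" "Q \<ge> 0"
    using \<open>c > 0\<close> \<open>LF \<ge> 0\<close> \<open>LC \<ge> 0\<close> by (auto simp: p_def Q_def add_nonneg_pos)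
  define d where "d = Min {1, dF, dC, dP, d1, dr / (1 + Q)}"
  have "d > 0" using \<open>dF > 0\<close> \<open>dC > 0\<close> \<open>dP > 0\<close> \<open>d1 > 0\<close> \<open>dr > 0\<close> \<open>Q \<ge> 0\<close>
    by (simp add: d_def)
  have d: "d \<le> 1" "d \<le> dF" "d \<le> dC" "d \<le> dP" "d \<le> d1" "d * (1 + Q) \<le> dr"
    using \<open>Q \<ge> 0\<close> by (simp_all add: d_def flip: pos_le_divide_eq)
  then have "d \<le> dr"
    using \<open>Q \<ge> 0\<close> \<open>d > 0\<close> by (smt (verit) mult_le_cancel_left1)

  have newton_step: "\<exists>\<eta>. (\<forall>\<zeta>. newton_system C P F F' X \<zeta> \<longleftrightarrow> \<zeta> = \<eta>) \<and> (X, \<eta>) \<in> T \<and>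
      norm (r (X, \<eta>) - Xs) \<le> (Q + Kr * (1 + Q)\<^sup>2) * (norm (X - Xs))\<^sup>2"
    if X: "X \<in> M" "norm (X - Xs) < d" for X
  proof -
    let ?A = "P X o\<^sub>L DF X" and ?N = "tangent_space C X"
    have balls: "X \<in> ball Xs dF" "X \<in> ball Xs dC" "Xs \<in> ball Xs dF" "Xs \<in> ball Xs dC"
      using X d \<open>d > 0\<close> by (auto simp: dist_norm norm_minus_commute)
    have N: "v \<in> ?N \<longleftrightarrow> DC X v = 0" for v
      using DC[OF balls(2)] by (simp add: tangent_space_def)
    have low: "c * norm v \<le> norm (?A v) + norm (DC X v)" for v
      using below[OF X(1)] X(2) d by (simp add: dist_norm)
    have sys: "newton_system C P F F' X \<zeta> \<longleftrightarrow> \<zeta> \<in> ?N \<and> ?A \<zeta> = - F X" for \<zeta>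
      using F'_tangent[OF X(1)] X(2) d \<open>d \<le> dr\<close>
      by (auto simp: newton_system_def tangent_space_def)
    have ker: "v = 0" if "v \<in> ?N" "?A v = 0" for v
      using low[of v] that \<open>c > 0\<close> N by (simp add: mult_le_0_iff)
    have inj: "inj_on ?A ?N"
      using ker tangent[of X]
      by (simp add: linear_injective_on_subspace_0 blinfun.bounded_linear_right bounded_linear.linear)
    have "?A ` ?N = range (P X)"
    proof (rule subspace_dim_equal)
      show "subspace (?A ` ?N)" "subspace (range (P X))"
        by (intro linear_subspace_image tangent subspace_UNIV bounded_linear.linear
            blinfun.bounded_linear_right)+
      show "?A ` ?N \<subseteq> range (P X)" by auto
      have "dim (?A ` ?N) = dim ?N"
        using inj tangent[of X]
        by (intro dim_image_eq bounded_linear.linear blinfun.bounded_linear_right)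
           (simp add: span_eq_iff[THEN iffD2])
      then show "dim (range (P X)) \<le> dim (?A ` ?N)" using dim_tangent[OF X(1)] by simp
    qed
    moreover have "- F X = P X (- F X)"
      using PF[OF X(1)] by (simp add: blinfun.minus_right)
    ultimately obtain \<eta> where \<eta>: "\<eta> \<in> ?N" "?A \<eta> = - F X"
      by (metis (no_types, lifting) imageE rangeI)
    have unique: "newton_system C P F F' X \<zeta> \<longleftrightarrow> \<zeta> = \<eta>" for \<zeta>
      unfolding sys using \<eta> inj by (metis inj_onD)

    have feasible: "C X = 0" "C Xs = 0"
      using X(1) Xs_feasible by (simp_all add: M_def feasible_set_def)
    define e where "e = norm (X - Xs)"
    have e: "0 \<le> e" "e < d" using X by (auto simp: e_def)
    (* X + \<eta> is the ambient Newton iterate; both components of its image under the system at X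
       turn into Taylor remainders at X, evaluated at Xs *)
    have "c * norm (X - Xs + \<eta>) \<le> norm (?A (X - Xs + \<eta>)) + norm (DC X (X - Xs + \<eta>))"
      by (rule low)
    also have "?A (X - Xs + \<eta>) = P X (F Xs - F X - DF X (Xs - X))"
      using \<eta>(2) PF[OF X(1)] Xs_solution
      by (simp add: blinfun.bilinear_simps)
    also have "norm \<dots> \<le> p * norm (F Xs - F X - DF X (Xs - X))"
      using P_bound X d by simp
    also have "\<dots> \<le> p * (LF * e\<^sup>2)"
      using G_Taylor[OF balls(1,3)] G(1)[OF X(1) balls(1)] G(1)[OF Xs_feasible balls(3)] \<open>p > 0\<close>
      by (simp add: e_def norm_minus_commute)
    also have "DC X (X - Xs + \<eta>) = C Xs - C X - DC X (Xs - X)"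
      using \<eta>(1)[unfolded N] feasible by (simp add: blinfun.add_right blinfun.diff_right)
    also have "norm \<dots> \<le> LC * e\<^sup>2"
      using H_Taylor[OF balls(2,4)] H(1)[OF balls(2)] H(1)[OF balls(4)]
      by (simp add: e_def norm_minus_commute)
    finally have "norm (X - Xs + \<eta>) \<le> Q * e\<^sup>2"
      using \<open>c > 0\<close> by (simp add: Q_def field_simps)
    moreover have "Q * e\<^sup>2 \<le> Q * e"
      using \<open>Q \<ge> 0\<close> e d by (simp add: power2_eq_square mult_left_le mult_left_mono)
    moreover have "norm \<eta> \<le> norm (X - Xs + \<eta>) + e"
      unfolding e_def by (metis add_diff_cancel_left' norm_triangle_ineq4)
    ultimately have newton: "norm (X - Xs + \<eta>) \<le> Q * e\<^sup>2" and \<eta>_le: "norm \<eta> \<le> (1 + Q) * e"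
      by (auto simp: algebra_simps)
    have "(1 + Q) * e < (1 + Q) * d" using e \<open>Q \<ge> 0\<close> by simp
    then have "norm \<eta> < dr" using \<eta>_le d(6) by (simp add: mult.commute)
    then have r: "(X, \<eta>) \<in> T" "norm (r (X, \<eta>) - (X + \<eta>)) \<le> Kr * (norm \<eta>)\<^sup>2"
      using retr2[OF X(1) \<eta>(1)] X(2) \<open>d \<le> dr\<close> by auto
    have "norm (r (X, \<eta>) - Xs) \<le> norm (X - Xs + \<eta>) + norm (r (X, \<eta>) - (X + \<eta>))"
      using norm_triangle_ineq[of "X - Xs + \<eta>" "r (X, \<eta>) - (X + \<eta>)"] by (simp add: algebra_simps)
    also have "\<dots> \<le> Q * e\<^sup>2 + Kr * ((1 + Q) * e)\<^sup>2"
      using newton r(2) \<eta>_le \<open>Kr \<ge> 0\<close>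
      by (smt (verit) mult_left_mono norm_ge_zero power_mono)
    also have "\<dots> = (Q + Kr * (1 + Q)\<^sup>2) * (norm (X - Xs))\<^sup>2"
      unfolding power_mult_distrib e_def by (simp add: distrib_right)
    finally show ?thesis using unique r(1) by blast
  qed

  obtain \<eta> where \<eta>: "\<And>X. X \<in> M \<Longrightarrow> norm (X - Xs) < d \<Longrightarrow>
      (\<forall>\<zeta>. newton_system C P F F' X \<zeta> \<longleftrightarrow> \<zeta> = \<eta> X) \<and> (X, \<eta> X) \<in> T \<and>
      norm (r (X, \<eta> X) - Xs) \<le> (Q + Kr * (1 + Q)\<^sup>2) * (norm (X - Xs))\<^sup>2"
    using newton_step by metis
  let ?next = "\<lambda>X. r (X, \<eta> X)"
  obtain \<delta> where "\<delta> > 0" "\<delta> \<le> d" and iter: "\<And>Y. Y \<in> M \<Longrightarrow> norm (Y - Xs) < \<delta> \<Longrightarrow>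
      (\<forall>i. (?next ^^ i) Y \<in> M \<and> norm ((?next ^^ i) Y - Xs) < \<delta>) \<and>
      converges_quadratically (\<lambda>i. (?next ^^ i) Y) Xs"
    using quadratic_iteration[OF \<open>d > 0\<close>, of M Xs ?next] \<eta> r_feasible by blast
  show ?thesis
  proof (intro exI[of _ \<delta>] conjI ballI impI)
    fix X0 assume X0: "X0 \<in> M" "norm (X0 - Xs) < \<delta>"
    let ?X = "\<lambda>i. (?next ^^ i) X0"
    have "?X i \<in> M" "norm (?X i - Xs) < d" for i
      using iter[OF X0] \<open>\<delta> \<le> d\<close> by (auto intro: less_le_trans)
    then show "\<exists>X \<eta>. X 0 = X0 \<and>
        (\<forall>i::nat. X i \<in> M \<and> (\<forall>\<zeta>. newton_system C P F F' (X i) \<zeta> \<longleftrightarrow> \<zeta> = \<eta> i) \<and>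
           (X i, \<eta> i) \<in> T \<and> X (Suc i) = r (X i, \<eta> i)) \<and> converges_quadratically X Xs"
      using iter[OF X0] \<eta>
      by (intro exI[of _ ?X] exI[of _ "\<lambda>i. \<eta> (?X i)"]) auto
  qed (rule \<open>\<delta> > 0\<close>)
qed

end
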